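(* Let $D, A, k, \eta, \omega$ be positive real numbers, put $\rho := \frac{k}{3.71 D}$ and assume $\rho<1$. Let $\hat e$ be a real parameter and define $$\alpha := \frac{2.51 A\eta}{D},\quad t:=\frac{2\alpha}{\rho\ln 10},\quad \Lambda:=\omega(2\log_{10}\rho)^{-2},\quad \hat a:=2t,\quad \hat b := (\ln\rho+1)t^2-\frac{\hat e^{\,2}}{2}.$$ Let $\phi^{HPPC}$ be the Hagen-Poiseuille Prandtl-Colebrook-White pressure loss function of the flow $q\in\mathbb{R}$ (defined in the context), and for real parameters $\ddot a,\ddot b,\ddot d$ let $$\phi^{fs}(q) := \Lambda\left(|q|+\ddot a+\frac{\ddot b}{|q|+\ddot d}\right)q .$$ If $\ddot a := \hat a$ and $\ddot b := \hat b + \hat e^{\,2}/2$, then $\phi^{fs}$ agrees with $\phi^{HPPC}$ asymptotically in value and in first and second derivative; that is, as $|q|\to\infty$, $$\phi^{fs}(q)-\phi^{HPPC}(q)\to 0,\qquad (\phi^{fs})'(q)-(\phi^{HPPC})'(q)\to 0,\qquad (\phi^{fs})''(q)-(\phi^{HPPC})''(q)\to 0 .$$ Moreover, if in addition $$\ddot d = \left(\frac{D\Lambda}{64\,\eta A\omega - 2tD\Lambda}\right)\ddot b,$$ where this expression is assumed to be well defined (nonzero denominator) and nonzero, then $$(\phi^{fs})'(0)=(\phi^{HPPC})'(0).$$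
   Context: The setting is a single fixed pipe of a gas network with diameter $D$, cross-sectional area $A$, roughness $k$, gas dynamic viscosity $\eta$, and friction constant $\omega>0$. The variable $q\in\mathbb{R}$ is the signed gas flow in the pipe, and all derivatives are with respect to $q$. $\ln$ is the natural logarithm and $\log_{10}$ the base-10 logarithm. Reynolds number: $Re := \frac{D}{A\eta}|q|$. Friction coefficient $\lambda(q)$ for $q\ne 0$ (HP-PC model): - if $Re\le 2320$ (laminar): $\lambda(q)=\frac{64}{Re}=\frac{64A\eta}{D|q|}$; - if $Re>2320$ (turbulent): $\lambda(q)>0$ is the solution of the implicit equation $\frac{1}{\sqrt{\lambda(q)}}=-2\log_{10}\left(\frac{2.51}{Re\sqrt{\lambda(q)}}+\frac{k}{3.71D}\right)$. HP-PC pressure loss: $\phi^{HPPC}(q):=\omega\,\lambda(q)\,|q|\,q$ for $q\neq0$ and $\phi^{HPPC}(0):=0$. In particular $\phi^{HPPC}$ is linear in the laminar range $Re\le 2320$. The function $\phi^{fs}$ is considered where $|q|+\ddot d\neq 0$ (in particular for all sufficiently large $|q|$, and near $q=0$ when $\ddot d\ne0$). In the asymptotic part of the claim $\ddot d$ is an arbitrary real number. The parameter $\hat e$ is a modeler-chosen parameter that enters only through $\hat b$. *)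

theory Defs
  imports "HOL-Analysis.Analysis"
begin

definition reynolds :: "real \<Rightarrow> real \<Rightarrow> real \<Rightarrow> real \<Rightarrow> real" where
  "reynolds D A \<eta> q = D / (A * \<eta>) * \<bar>q\<bar>"

text \<open>The Prandtl--Colebrook--White equation for the friction coefficient \<open>l\<close> at Reynolds number \<open>R\<close>.\<close>

definition colebrook :: "real \<Rightarrow> real \<Rightarrow> real \<Rightarrow> real \<Rightarrow> bool" where
  "colebrook D k R l \<longleftrightarrow>
     1 / sqrt l = - 2 * log 10 (2.51 / (R * sqrt l) + k / (3.71 * D))"

text \<open>Only meaningful for \<open>q \<noteq> 0\<close>. The description operator in the turbulent range is justified by
  \<open>colebrook_ex1\<close> below.\<close>

definition friction :: "real \<Rightarrow> real \<Rightarrow> real \<Rightarrow> real \<Rightarrow> real \<Rightarrow> real" where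
  "friction D A k \<eta> q =
     (if reynolds D A \<eta> q \<le> 2320 then 64 / reynolds D A \<eta> q
      else (THE l. l > 0 \<and> colebrook D k (reynolds D A \<eta> q) l))"

definition phi_HPPC :: "real \<Rightarrow> real \<Rightarrow> real \<Rightarrow> real \<Rightarrow> real \<Rightarrow> real \<Rightarrow> real" where
  "phi_HPPC D A k \<eta> \<omega> q = (if q = 0 then 0 else \<omega> * friction D A k \<eta> q * \<bar>q\<bar> * q)"

text \<open>Only meaningful where \<open>\<bar>q\<bar> + d \<noteq> 0\<close>.\<close>

definition phi_fs :: "real \<Rightarrow> real \<Rightarrow> real \<Rightarrow> real \<Rightarrow> real \<Rightarrow> real" where
  "phi_fs \<Lambda> a b d q = \<Lambda> * (\<bar>q\<bar> + a + b / (\<bar>q\<bar> + d)) * q"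

definition twice_differentiable_at :: "(real \<Rightarrow> real) \<Rightarrow> real \<Rightarrow> bool" where
  "twice_differentiable_at f x \<longleftrightarrow>
     (\<forall>\<^sub>F y in nhds x. f differentiable at y) \<and> deriv f differentiable at x"

lemma colebrook_ex1:
  assumes "D > 0" "k > 0" "k / (3.71 * D) < 1" "R > 0"
  shows "\<exists>!l. l > 0 \<and> colebrook D k R l"
proof -
  define r where "r = k / (3.71 * D)"
  have r: "0 < r" "r < 1" using assms by (simp_all add: r_def)
  define g where "g x = x + 2 * log 10 (2.51 * x / R + r)" for x :: real
  have pos: "2.51 * x / R + r > 0" if "x \<ge> 0" for x
    using that r assms by (intro add_nonneg_pos) auto
  have mono: "g x < g y" if "0 \<le> x" "x < y" for x y
  proof -
    have "2.51 * x / R + r < 2.51 * y / R + r"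
      using that assms by (simp add: divide_strict_right_mono)
    with pos[of x] pos[of y] that show ?thesis
      unfolding g_def by (intro add_strict_mono) (auto simp: log_less_cancel_iff)
  qed
  define x0 where "x0 = - 2 * log 10 r"
  have "x0 > 0" using r by (simp add: x0_def)
  have g0: "g 0 < 0" using r by (simp add: g_def)
  have "log 10 r \<le> log 10 (2.51 * x0 / R + r)"
    using r pos[of x0] \<open>x0 > 0\<close> assms by (subst log_le_cancel_iff) auto
  hence g1: "0 \<le> g x0" by (simp add: g_def x0_def)
  have "continuous_on {0..x0} g"
    unfolding g_def using pos assms by (intro continuous_intros) (auto simp: less_imp_neq[symmetric])
  with g0 g1 \<open>x0 > 0\<close> obtain x where x: "0 \<le> x" "g x = 0"
    using IVT'[of g 0 0 x0] by force
  with g0 have "x > 0" by (cases "x = 0") auto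
  have eq: "colebrook D k R l \<longleftrightarrow> g (1 / sqrt l) = 0" if "l > 0" for l
    unfolding colebrook_def g_def r_def by (auto simp: mult_ac)
  show ?thesis
  proof (rule ex1I[of _ "1 / x\<^sup>2"])
    show "1 / x\<^sup>2 > 0 \<and> colebrook D k R (1 / x\<^sup>2)"
      using \<open>x > 0\<close> x eq[of "1 / x\<^sup>2"] by (simp add: real_sqrt_divide)
  next
    fix l assume l: "l > 0 \<and> colebrook D k R l"
    hence "g (1 / sqrt l) = 0" using eq by blast
    moreover have "1 / sqrt l \<ge> 0" using l by simp
    ultimately have "1 / sqrt l = x"
      using mono[of x "1 / sqrt l"] mono[of "1 / sqrt l" x] x by (cases "1 / sqrt l" x rule: linorder_cases) auto
    hence "x\<^sup>2 = 1 / l" using l by (auto simp: power_divide)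
    thus "l = 1 / x\<^sup>2" using l by simp
  qed
qed

end

theory Submission
  imports Defs "HOL-Complex_Analysis.Conformal_Mappings" "HOL-Real_Asymp.Real_Asymp"
begin

text \<open>
  With \<open>L = - ln \<rho>\<close> and \<open>\<lambda>\<close> the friction coefficient, put \<open>v = \<alpha> / (\<rho> \<bar>q\<bar> sqrt \<lambda>)\<close>. The Colebrook
  equation then says \<open>\<bar>q\<bar> = t (L - ln (1 + v)) / v\<close>, and the turbulent pressure loss at \<open>q > 0\<close> is
  \<open>\<Lambda> t\<^sup>2 L\<^sup>2 / v\<^sup>2\<close>. Hence the loss and its first two derivatives are explicit functions of \<open>v\<close>,
  and \<open>\<bar>q\<bar> \<rightarrow> \<infinity>\<close> corresponds to \<open>v \<rightarrow> 0+\<close>. For \<open>q > 0\<close> one has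
  \<open>\<phi>\<^sup>f\<^sup>s(q) = \<Lambda> (q\<^sup>2 + a q + b - b d / (q + d))\<close>, so only a quadratic polynomial in \<open>q\<close> has to be compared
  with the Laurent expansion at \<open>v = 0\<close>. Negative flows follow because both functions are odd.
\<close>

section \<open>Derivatives and limits of odd functions, reduced to positive arguments\<close>

lemma has_real_derivative_odd_abs:
  fixes f f' :: "real \<Rightarrow> real"
  assumes odd: "\<And>x. f (- x) = - f x"
    and der: "\<And>x. x > M \<Longrightarrow> (f has_real_derivative f' x) (at x)"
    and x: "\<bar>x\<bar> > M"
  shows "(f has_real_derivative f' \<bar>x\<bar>) (at x)"
proof (cases "x \<ge> 0")
  case True
  with der x show ?thesis by simp
next
  case False
  with x have "(f has_real_derivative f' (- x)) (at (- x))" by (intro der) simp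
  then have "((\<lambda>x. f (- x)) has_real_derivative - f' (- x)) (at x)"
    by (simp add: DERIV_mirror)
  then have "((\<lambda>x. - f x) has_real_derivative - f' (- x)) (at x)" by (simp add: odd)
  from DERIV_minus[OF this] False show ?thesis by simp
qed

lemma has_real_derivative_abs:
  fixes x :: real
  assumes "x \<noteq> 0"
  shows "(abs has_real_derivative sgn x) (at x)"
proof (cases "x > 0")
  case True
  show ?thesis
    by (rule has_field_derivative_transform_within_open[where f = "\<lambda>x. x" and S = "{0<..}"])
      (use True in \<open>auto intro!: derivative_eq_intros\<close>)
next
  case False
  show ?thesis
    by (rule has_field_derivative_transform_within_open[where f = uminus and S = "{..<0}"])
      (use False assms in \<open>auto intro!: derivative_eq_intros\<close>)
qed

lemma has_real_derivative_even_abs: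
  fixes f f' :: "real \<Rightarrow> real"
  assumes "M \<ge> 0"
    and der: "\<And>x. x > M \<Longrightarrow> (f has_real_derivative f' x) (at x)"
    and x: "\<bar>x\<bar> > M"
  shows "((\<lambda>x. f \<bar>x\<bar>) has_real_derivative sgn x * f' \<bar>x\<bar>) (at x)"
proof -
  have "x \<noteq> 0" using assms by auto
  have "(f has_real_derivative f' \<bar>x\<bar>) (at \<bar>x\<bar>)" using der x by simp
  from DERIV_chain2[OF this has_real_derivative_abs[OF \<open>x \<noteq> 0\<close>]] show ?thesis
    by (simp add: mult.commute)
qed

text \<open>Differentiation turns an odd function into an even one and back, hence the bare
  \<open>\<bar>x\<bar>\<close> in the first derivative and the factor \<open>sgn x\<close> in the
  second. Explicit formulas are thus needed only for positive flows beyond \<open>M\<close>.\<close>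

lemma
  fixes f f' f'' :: "real \<Rightarrow> real"
  assumes "M \<ge> 0"
    and odd: "\<And>x. f (- x) = - f x"
    and der: "\<And>x. x > M \<Longrightarrow> (f has_real_derivative f' x) (at x)"
    and der2: "\<And>x. x > M \<Longrightarrow> (f' has_real_derivative f'' x) (at x)"
    and x: "\<bar>x\<bar> > M"
  shows twice_differentiable_at_odd: "twice_differentiable_at f x"
    and deriv_odd_abs: "deriv f x = f' \<bar>x\<bar>"
    and deriv_deriv_odd_abs: "deriv (deriv f) x = sgn x * f'' \<bar>x\<bar>"
proof -
  have D1: "(f has_real_derivative f' \<bar>y\<bar>) (at y)" if "\<bar>y\<bar> > M" for y
    by (rule has_real_derivative_odd_abs[where f = f and M = M, OF odd der that])
  \<comment> \<open>Differentiating \<open>deriv f\<close> requires its formula on a whole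
    neighbourhood of \<open>x\<close>, which this open set provides.\<close>
  have "open {y. M < \<bar>y\<bar>}" by (intro open_Collect_less continuous_intros)
  from eventually_nhds_in_open[OF this, of x] x have ev: "\<forall>\<^sub>F y in nhds x. \<bar>y\<bar> > M" by simp
  from ev have ev': "\<forall>\<^sub>F y in nhds x. deriv f y = f' \<bar>y\<bar>"
    by eventually_elim (rule DERIV_imp_deriv[OF D1])
  have D2: "(deriv f has_real_derivative sgn x * f'' \<bar>x\<bar>) (at x)"
    using has_real_derivative_even_abs[where f = f', OF \<open>M \<ge> 0\<close> der2 x] DERIV_cong_ev[OF refl ev' refl] by simp
  from ev have "\<forall>\<^sub>F y in nhds x. f differentiable at y"
    by eventually_elim (use D1 real_differentiable_def in blast)
  with D2 show "twice_differentiable_at f x"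
    unfolding twice_differentiable_at_def real_differentiable_def by blast
  show "deriv f x = f' \<bar>x\<bar>" by (rule DERIV_imp_deriv[OF D1[OF x]])
  show "deriv (deriv f) x = sgn x * f'' \<bar>x\<bar>" by (rule DERIV_imp_deriv[OF D2])
qed

lemma filterlim_abs_at_infinity: "filterlim (abs :: real \<Rightarrow> real) at_top at_infinity"
  using filterlim_norm_at_top[where 'a = real] by (simp add: real_norm_def[abs_def])

lemma tendsto_sgn_mult_abs_at_infinity:
  fixes f :: "real \<Rightarrow> real"
  assumes "(f \<longlongrightarrow> 0) at_top"
  shows "((\<lambda>x. sgn x * f \<bar>x\<bar>) \<longlongrightarrow> 0) at_infinity"
proof (rule Lim_null_comparison)
  from tendsto_rabs_zero[OF filterlim_compose[OF assms filterlim_abs_at_infinity]]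
  show "((\<lambda>x. \<bar>f \<bar>x\<bar>\<bar>) \<longlongrightarrow> 0) at_infinity" .
  show "\<forall>\<^sub>F x in at_infinity. norm (sgn x * f \<bar>x\<bar>) \<le> \<bar>f \<bar>x\<bar>\<bar>"
    by (intro always_eventually) (auto simp: abs_mult sgn_real_def)
qed

subsection \<open>Flow as a function of the friction parameter\<close>

definition flow_of :: "real \<Rightarrow> real \<Rightarrow> real \<Rightarrow> real" where
  "flow_of t L v = t * (L - ln (1 + v)) / v"

text \<open>The right end point is the zero of \<open>L - ln (1 + v)\<close>, so for
  \<open>t > 0\<close> these are the positive parameters at which the flow is positive.\<close>

definition flow_dom :: "real \<Rightarrow> real set" where
  "flow_dom L = {0<..<exp L - 1}"

text \<open>Meaningful only for \<open>q\<close> in the image of \<open>flow_dom L\<close>;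
  elsewhere \<open>inv_into\<close> gives an unspecified value.\<close>

definition param_of :: "real \<Rightarrow> real \<Rightarrow> real \<Rightarrow> real" where
  "param_of t L q = inv_into (flow_dom L) (flow_of t L) q"

text \<open>The derivative of the flow is \<open>- t / v\<^sup>2\<close> times this quantity, which tends to \<open>L\<close> at \<open>0\<close>.\<close>

definition slope_num :: "real \<Rightarrow> real \<Rightarrow> real" where
  "slope_num L v = L - ln (1 + v) + v / (1 + v)"

lemma flow_domD:
  assumes "v \<in> flow_dom L"
  shows "v > 0" "ln (1 + v) < L"
proof -
  show v: "v > 0" using assms by (simp add: flow_dom_def)
  have "1 + v < exp L" using assms by (simp add: flow_dom_def)
  then have "ln (1 + v) < ln (exp L)" using v by (intro ln_strict_mono) auto
  then show "ln (1 + v) < L" by simp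
qed

lemma flow_domI:
  assumes "v > 0" "ln (1 + v) < L"
  shows "v \<in> flow_dom L"
  using assms by (simp add: flow_dom_def) (smt (verit) exp_less_mono exp_ln)

lemma slope_num_pos: "v \<in> flow_dom L \<Longrightarrow> slope_num L v > 0"
  using flow_domD[of v L] by (simp add: slope_num_def add_pos_pos)

text \<open>On the domain the numerator is positive and decreasing while the denominator grows, so
  the flow decreases strictly.\<close>

lemma inj_on_flow_of:
  assumes "t > 0"
  shows "inj_on (flow_of t L) (flow_dom L)"
proof -
  have "flow_of t L y < flow_of t L x" if "x \<in> flow_dom L" "y \<in> flow_dom L" "x < y" for x y
  proof -
    have "ln (1 + x) < ln (1 + y)" using that flow_domD by fastforce
    then show ?thesis unfolding flow_of_def
      using that flow_domD[of x L] flow_domD[of y L] assms by (intro frac_less) auto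
  qed
  then show ?thesis by (intro linorder_inj_onI') (metis less_irrefl)
qed

lemma has_real_derivative_flow_of:
  assumes "v > 0"
  shows "(flow_of t L has_real_derivative - t * slope_num L v / v\<^sup>2) (at v)"
proof -
  have "((\<lambda>v. t * (L - ln (1 + v)) / v) has_real_derivative - t * slope_num L v / v\<^sup>2) (at v)"
    using assms unfolding slope_num_def
    by (auto intro!: derivative_eq_intros simp: field_simps power2_eq_square)
  then show ?thesis unfolding flow_of_def[abs_def] .
qed

lemma param_of_flow_of:
  "t > 0 \<Longrightarrow> v \<in> flow_dom L \<Longrightarrow> param_of t L (flow_of t L v) = v"
  by (simp add: param_of_def inj_on_flow_of inv_into_f_f)

text \<open>Inverse function rule on the open interval \<open>flow_dom L\<close>. Taking the
  derivative at \<open>flow_of t L v\<close> keeps its value explicit in \<open>v\<close>, although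
  \<open>param_of\<close> itself has no formula.\<close>

lemma has_real_derivative_param_of:
  assumes "t > 0" "v \<in> flow_dom L"
  shows "(param_of t L has_real_derivative - v\<^sup>2 / (t * slope_num L v)) (at (flow_of t L v))"
proof -
  have v: "v > 0" and s: "slope_num L v > 0"
    using assms flow_domD slope_num_pos by auto
  have inv: "param_of t L (flow_of t L v) = v" using assms by (rule param_of_flow_of)
  have "(param_of t L has_real_derivative inverse (- t * slope_num L v / v\<^sup>2)) (at (flow_of t L v))"
  proof (rule has_field_derivative_inverse_strong_x[where S = "flow_dom L" and f = "flow_of t L"])
    show "(flow_of t L has_real_derivative - t * slope_num L v / v\<^sup>2)
        (at (param_of t L (flow_of t L v)))"
      unfolding inv using v by (rule has_real_derivative_flow_of)
    show "continuous_on (flow_dom L) (flow_of t L)"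
      by (meson continuous_at_imp_continuous_on DERIV_isCont has_real_derivative_flow_of flow_domD(1))
  qed (use assms v s inv param_of_flow_of in \<open>auto simp: flow_dom_def\<close>)
  then show ?thesis by (simp add: field_simps)
qed

text \<open>Since \<open>ln (1 + v) > 0\<close>, the flow is below \<open>t * L / v\<close>; so the
  parameter lies between \<open>0\<close> and \<open>t * L / q\<close>. The solvability of the
  Colebrook equation later supplies \<open>surj\<close>.\<close>

lemma filterlim_param_of:
  assumes "t > 0"
    and surj: "\<And>q. q > M \<Longrightarrow> q \<in> flow_of t L ` flow_dom L"
  shows "filterlim (param_of t L) (at_right 0) at_top"
proof -
  have bnd: "0 < param_of t L q \<and> param_of t L q \<le> t * L / q" if q: "q > max M 0" for q
  proof -
    from surj q obtain v where v: "v \<in> flow_dom L" "q = flow_of t L v" by auto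
    have "t * (L - ln (1 + v)) \<le> t * L" using flow_domD[OF v(1)] assms by simp
    with v flow_domD[OF v(1)] q have "v \<le> t * L / q" by (simp add: flow_of_def field_simps)
    with v flow_domD[OF v(1)] assms param_of_flow_of show ?thesis by simp
  qed
  have ev: "\<forall>\<^sub>F q in at_top. q > max M 0" by (rule eventually_gt_at_top)
  have "(param_of t L \<longlongrightarrow> 0) at_top"
  proof (rule tendsto_sandwich)
    show "\<forall>\<^sub>F q in at_top. 0 \<le> param_of t L q" using ev by eventually_elim (use bnd less_imp_le in blast)
    show "\<forall>\<^sub>F q in at_top. param_of t L q \<le> t * L / q" using ev by eventually_elim (use bnd in blast)
    show "((\<lambda>q. t * L / q) \<longlongrightarrow> 0) at_top" by real_asymp
  qed auto
  moreover have "\<forall>\<^sub>F q in at_top. param_of t L q \<in> {0<..} \<and> param_of t L q \<noteq> 0"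
    using ev by eventually_elim (use bnd in force)
  ultimately show ?thesis by (simp add: filterlim_at)
qed

section \<open>Derivatives of the turbulent loss and their behaviour as the parameter tends to
  zero\<close>

text \<open>Up to a factor \<open>t\<close>, the derivative of
  \<open>t\<^sup>2 * L\<^sup>2 / v\<^sup>2\<close> with respect to the flow: the quotient of its
  \<open>v\<close>-derivative by that of \<open>flow_of\<close>.\<close>

definition loss_deriv :: "real \<Rightarrow> real \<Rightarrow> real" where
  "loss_deriv L v = 2 * L\<^sup>2 / (v * slope_num L v)"

text \<open>No \<open>t\<close> remains in the second derivative, because the loss scales with the
  square of \<open>t\<close> and the flow with \<open>t\<close>.\<close>

definition loss_deriv2 :: "real \<Rightarrow> real \<Rightarrow> real" where
  "loss_deriv2 L v = 2 * L\<^sup>2 * (slope_num L v - v\<^sup>2 / (1 + v)\<^sup>2) / slope_num L v ^ 3"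

lemma has_real_derivative_loss:
  assumes "t > 0" "v \<in> flow_dom L"
  shows "((\<lambda>q. t\<^sup>2 * L\<^sup>2 / (param_of t L q)\<^sup>2) has_real_derivative t * loss_deriv L v) (at (flow_of t L v))"
    (is ?first)
    and "((\<lambda>q. t * loss_deriv L (param_of t L q)) has_real_derivative loss_deriv2 L v) (at (flow_of t L v))"
    (is ?second)
proof -
  have v: "v > 0" and s: "slope_num L v > 0"
    using assms flow_domD slope_num_pos by auto
  note inv = param_of_flow_of[OF assms] and D = has_real_derivative_param_of[OF assms]
  show ?first
    using v s \<open>t > 0\<close> unfolding loss_deriv_def
    by (auto intro!: derivative_eq_intros D simp: inv) (simp add: field_simps power2_eq_square power4_eq_xxxx)
  have N: "(slope_num L has_real_derivative - v / (1 + v)\<^sup>2) (at v)"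
  proof -
    have "((\<lambda>v. L - ln (1 + v) + v / (1 + v)) has_real_derivative
        - (1 / (1 + v)) + (1 + v - v) / ((1 + v) * (1 + v))) (at v)"
      using v by (auto intro!: derivative_eq_intros)
    also have "- (1 / (1 + v)) + (1 + v - v) / ((1 + v) * (1 + v)) = - v / (1 + v)\<^sup>2"
      using v by (simp add: divide_simps) (simp add: power2_eq_square algebra_simps)
    finally show ?thesis by (simp add: slope_num_def[abs_def])
  qed
  \<comment> \<open>By \<open>N\<close>, the denominator \<open>v * slope_num L v\<close> has
    derivative \<open>slope_num L v - v\<^sup>2 / (1 + v)\<^sup>2\<close>.\<close>
  have "(loss_deriv L has_real_derivative
      - 2 * L\<^sup>2 * (slope_num L v - v\<^sup>2 / (1 + v)\<^sup>2) / (v * slope_num L v)\<^sup>2) (at v)"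
    using v s unfolding loss_deriv_def[abs_def]
    by (auto intro!: derivative_eq_intros N) (simp add: field_simps power2_eq_square)
  then have "(loss_deriv L has_real_derivative
      - 2 * L\<^sup>2 * (slope_num L v - v\<^sup>2 / (1 + v)\<^sup>2) / (v * slope_num L v)\<^sup>2)
      (at (param_of t L (flow_of t L v)))" by (simp add: inv)
  from DERIV_cmult[OF DERIV_chain2[OF this D], of t] show ?second
    by (rule DERIV_cong) (use v s \<open>t > 0\<close> in \<open>simp add: loss_deriv2_def field_simps power2_eq_square power3_eq_cube\<close>)
qed

text \<open>The expansion of \<open>ln (1 + v)\<close> gives
  \<open>t * L / v - t + t * v / 2\<close> for the flow, up to higher order. In its square the
  simple pole is cancelled exactly by the linear term with coefficient \<open>2 * t\<close>, leaving
  the constant \<open>(L - 1) * t\<^sup>2\<close>. This is the origin of \<open>a_hat\<close> and,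
  with opposite sign, of \<open>b\<close>.\<close>

lemma flow_of_asymptotics:
  assumes "L > 0"
  shows "((\<lambda>v. (flow_of t L v)\<^sup>2 + 2 * t * flow_of t L v - t\<^sup>2 * L\<^sup>2 / v\<^sup>2) \<longlongrightarrow> (L - 1) * t\<^sup>2) (at_right 0)"
      (is ?value)
    and "((\<lambda>v. 2 * flow_of t L v + 2 * t - t * loss_deriv L v) \<longlongrightarrow> 0) (at_right 0)" (is ?first)
    and "(loss_deriv2 L \<longlongrightarrow> 2) (at_right 0)" (is ?second)
proof -
  have pos: "\<forall>\<^sub>F v in at_right (0::real). v > 0" by (rule eventually_at_right_less)
  \<comment> \<open>Sorting by powers of \<open>L\<close> leaves limits in \<open>v\<close> alone,
    which \<open>real_asymp\<close> can evaluate; the terms in \<open>L\<^sup>2\<close>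
    cancel.\<close>
  have "((\<lambda>v. t\<^sup>2 * (2 * L * ((v - ln (1 + v)) / v\<^sup>2) + ((ln (1 + v) / v)\<^sup>2 - 2 * (ln (1 + v) / v))))
      \<longlongrightarrow> t\<^sup>2 * (2 * L * (1 / 2) + (-1))) (at_right 0)"
  proof -
    have "((\<lambda>v::real. (v - ln (1 + v)) / v\<^sup>2) \<longlongrightarrow> 1 / 2) (at_right 0)"
      "((\<lambda>v::real. (ln (1 + v) / v)\<^sup>2 - 2 * (ln (1 + v) / v)) \<longlongrightarrow> -1) (at_right 0)"
      by real_asymp+
    then show ?thesis by (intro tendsto_mult_left tendsto_add)
  qed
  moreover have "\<forall>\<^sub>F v in at_right 0. t\<^sup>2 * (2 * L * ((v - ln (1 + v)) / v\<^sup>2) + ((ln (1 + v) / v)\<^sup>2 - 2 * (ln (1 + v) / v)))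
        = (flow_of t L v)\<^sup>2 + 2 * t * flow_of t L v - t\<^sup>2 * L\<^sup>2 / v\<^sup>2"
    using pos by eventually_elim (simp add: flow_of_def field_simps power2_eq_square)
  ultimately show ?value
    by (rule tendsto_eq_rhs[OF Lim_transform_eventually]) (simp add: algebra_simps)
  have N: "(slope_num L \<longlongrightarrow> L) (at_right 0)"
  proof -
    have "((\<lambda>v::real. ln (1 + v) - v / (1 + v)) \<longlongrightarrow> 0) (at_right 0)" by real_asymp
    from tendsto_diff[OF tendsto_const[of L] this] show ?thesis by (simp add: slope_num_def[abs_def] algebra_simps)
  qed
  have ev: "\<forall>\<^sub>F v in at_right 0. slope_num L v > 0"
    using order_tendstoD(1)[OF N \<open>L > 0\<close>] .
  have "((\<lambda>v. 2 * t * (L * (1 + 1 / (1 + v) - 2 * (ln (1 + v) / v))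
      + ((ln (1 + v))\<^sup>2 / v - ln (1 + v) / (1 + v) - ln (1 + v) + v / (1 + v))) / slope_num L v)
      \<longlongrightarrow> 2 * t * (L * 0 + 0) / L) (at_right 0)"
  proof -
    have "((\<lambda>v::real. 1 + 1 / (1 + v) - 2 * (ln (1 + v) / v)) \<longlongrightarrow> 0) (at_right 0)"
      "((\<lambda>v::real. (ln (1 + v))\<^sup>2 / v - ln (1 + v) / (1 + v) - ln (1 + v) + v / (1 + v)) \<longlongrightarrow> 0) (at_right 0)"
      by real_asymp+
    then have "((\<lambda>v. 2 * t * (L * (1 + 1 / (1 + v) - 2 * (ln (1 + v) / v))
      + ((ln (1 + v))\<^sup>2 / v - ln (1 + v) / (1 + v) - ln (1 + v) + v / (1 + v))))
      \<longlongrightarrow> 2 * t * (L * 0 + 0)) (at_right 0)"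
      by (intro tendsto_mult_left tendsto_add)
    from tendsto_divide[OF this N] assms show ?thesis by simp
  qed
  moreover have "\<forall>\<^sub>F v in at_right 0. 2 * t * (L * (1 + 1 / (1 + v) - 2 * (ln (1 + v) / v))
      + ((ln (1 + v))\<^sup>2 / v - ln (1 + v) / (1 + v) - ln (1 + v) + v / (1 + v))) / slope_num L v
      = 2 * flow_of t L v + 2 * t - t * loss_deriv L v"
    using pos ev
  proof eventually_elim
    case (elim v)
    \<comment> \<open>Writing \<open>ln (1 + v)\<close> as \<open>u * v\<close> makes the numerator
      a polynomial from which the factor \<open>v\<close> of the denominator splits off.\<close>
    define u w where "u = ln (1 + v) / v" and "w = 1 / (1 + v)"
    have u: "ln (1 + v) = u * v" using elim by (simp add: u_def)
    have slope: "slope_num L v = L - ln (1 + v) + v * w" by (simp add: slope_num_def w_def)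
    have "2 * flow_of t L v + 2 * t - t * loss_deriv L v
        = 2 * t * (((L - ln (1 + v)) + v) * slope_num L v - L\<^sup>2) / (v * slope_num L v)"
      using elim by (simp add: flow_of_def loss_deriv_def field_simps)
    also have "((L - ln (1 + v)) + v) * slope_num L v - L\<^sup>2
        = v * (L * (1 + w - 2 * u) + (u\<^sup>2 * v - u * v * w - u * v + v * w))"
      by (simp add: slope u algebra_simps power2_eq_square)
    also have "\<dots> = v * (L * (1 + 1 / (1 + v) - 2 * (ln (1 + v) / v))
      + ((ln (1 + v))\<^sup>2 / v - ln (1 + v) / (1 + v) - ln (1 + v) + v / (1 + v)))"
      using elim by (simp add: u w_def power2_eq_square)
    finally show ?case using elim by simp
  qed
  ultimately show ?first
    by (rule tendsto_eq_rhs[OF Lim_transform_eventually]) simp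
  have sq: "((\<lambda>v::real. v\<^sup>2 / (1 + v)\<^sup>2) \<longlongrightarrow> 0) (at_right 0)" by real_asymp
  have "((\<lambda>v. 2 * L\<^sup>2 * (slope_num L v - v\<^sup>2 / (1 + v)\<^sup>2) / slope_num L v ^ 3)
      \<longlongrightarrow> 2 * L\<^sup>2 * (L - 0) / L ^ 3) (at_right 0)"
    by (intro tendsto_intros N sq) (use assms in simp)
  then show ?second using assms
    by (simp add: loss_deriv2_def[abs_def] power2_eq_square power3_eq_cube)
qed

subsection \<open>The two pressure losses\<close>

lemma phi_HPPC_minus: "phi_HPPC D A k \<eta> \<omega> (- q) = - phi_HPPC D A k \<eta> \<omega> q"
  by (simp add: phi_HPPC_def friction_def reynolds_def)

lemma phi_fs_minus: "phi_fs \<Lambda> a b d (- q) = - phi_fs \<Lambda> a b d q"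
  by (simp add: phi_fs_def)

text \<open>One witness \<open>v\<close> serves twice: it shows that every turbulent flow is in the
  image of \<open>flow_of\<close>, and it expresses the loss without the implicitly defined friction
  coefficient.\<close>

lemma phi_HPPC_turbulent:
  assumes "D > 0" "A > 0" "k > 0" "\<eta> > 0"
    and \<rho>: "\<rho> = k / (3.71 * D)" "\<rho> < 1"
    and \<alpha>: "\<alpha> = 2.51 * A * \<eta> / D"
    and t: "t = 2 * \<alpha> / (\<rho> * ln 10)"
    and q: "q > 2320 * A * \<eta> / D"
  obtains v where "v \<in> flow_dom (- ln \<rho>)" "flow_of t (- ln \<rho>) v = q"
    "phi_HPPC D A k \<eta> \<omega> q = \<omega> * (2 * log 10 \<rho>) powi (- 2) * (t\<^sup>2 * (- ln \<rho>)\<^sup>2 / v\<^sup>2)"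
proof -
  have \<rho>0: "\<rho> > 0" and \<alpha>0: "\<alpha> > 0" using assms by simp_all
  have "2320 * A * \<eta> / D > 0" using assms by simp
  then have q0: "q > 0" using q by linarith
  have R: "reynolds D A \<eta> q > 2320"
    using q q0 assms(1-4) by (simp add: reynolds_def field_simps)
  define l where "l = friction D A k \<eta> q"
  have "l > 0 \<and> colebrook D k (reynolds D A \<eta> q) l"
    unfolding l_def friction_def using R theI'[OF colebrook_ex1, of D k "reynolds D A \<eta> q"] assms by simp
  then have l: "l > 0" and c: "colebrook D k (reynolds D A \<eta> q) l" by auto
  \<comment> \<open>The ratio of the two summands inside the Colebrook logarithm, whose argument
    therefore factors as \<open>\<rho> * (1 + v)\<close>.\<close>
  define v where "v = \<alpha> / (\<rho> * q * sqrt l)"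
  have v: "v > 0" using l q0 \<rho>0 \<alpha>0 by (simp add: v_def)
  have "2.51 / (reynolds D A \<eta> q * sqrt l) + k / (3.71 * D) = \<rho> * (1 + v)"
    using q0 l assms(1-4) \<rho>0 unfolding v_def \<rho>(1)[symmetric] by (simp add: \<alpha> reynolds_def field_simps)
  with c have "1 / sqrt l = - 2 * log 10 (\<rho> * (1 + v))" by (simp add: colebrook_def)
  also have "\<dots> = 2 * (- ln \<rho> - ln (1 + v)) / ln 10"
    using \<rho>0 v by (simp add: log_def ln_mult minus_divide_left)
  finally have x: "1 / sqrt l = 2 * (- ln \<rho> - ln (1 + v)) / ln 10" .
  have "1 / sqrt l > 0" using l by simp
  then have "ln (1 + v) < - ln \<rho>" unfolding x by (simp add: zero_less_divide_iff)
  with v have dom: "v \<in> flow_dom (- ln \<rho>)" by (rule flow_domI)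
  have "t * y / v = \<alpha> / (\<rho> * v) * (2 * y / ln 10)" for y by (simp add: t mult_ac)
  then have "flow_of t (- ln \<rho>) v = \<alpha> / (\<rho> * v) * (2 * (- ln \<rho> - ln (1 + v)) / ln 10)"
    unfolding flow_of_def .
  also have "\<dots> = q"
    unfolding x[symmetric] using \<alpha>0 \<rho>0 l q0 by (simp add: v_def)
  finally have flow: "flow_of t (- ln \<rho>) v = q" .
  have "ln \<rho> \<noteq> 0" using \<rho>0 \<rho>(2) by simp
  have "phi_HPPC D A k \<eta> \<omega> q = \<omega> * l * q\<^sup>2"
    using q0 by (simp add: phi_HPPC_def l_def power2_eq_square)
  also have "\<dots> = \<omega> * (\<alpha> / (\<rho> * v))\<^sup>2"
    using q0 l \<rho>0 \<alpha>0 by (simp add: v_def power_mult_distrib)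
  \<comment> \<open>Here \<open>t * (- ln \<rho>)\<close> equals
    \<open>- 2 * log 10 \<rho> * \<alpha> / \<rho>\<close>, so the logarithms cancel.\<close>
  also have "\<dots> = \<omega> * (2 * log 10 \<rho>) powi (- 2) * (t\<^sup>2 * (- ln \<rho>)\<^sup>2 / v\<^sup>2)"
    using \<rho>0 v \<open>ln \<rho> \<noteq> 0\<close>
    by (simp add: t log_def power_int_minus field_simps)
  finally show thesis using that dom flow by blast
qed

section \<open>The laminar range and the slopes at zero flow\<close>

lemma phi_HPPC_laminar:
  assumes "D > 0" "A > 0" "\<eta> > 0" "\<bar>q\<bar> \<le> 2320 * A * \<eta> / D"
  shows "phi_HPPC D A k \<eta> \<omega> q = 64 * \<eta> * A * \<omega> / D * q"
proof -
  have "reynolds D A \<eta> q \<le> 2320"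
    using assms by (simp add: reynolds_def field_simps)
  then show ?thesis
    using assms by (simp add: phi_HPPC_def friction_def) (simp add: reynolds_def)
qed

lemma has_real_derivative_phi_HPPC_0:
  assumes "D > 0" "A > 0" "\<eta> > 0"
  shows "(phi_HPPC D A k \<eta> \<omega> has_real_derivative 64 * \<eta> * A * \<omega> / D) (at 0)"
proof (rule has_field_derivative_transform_within_open)
  show "((\<lambda>q. 64 * \<eta> * A * \<omega> / D * q) has_real_derivative 64 * \<eta> * A * \<omega> / D) (at 0)"
    using assms by (auto intro!: derivative_eq_intros)
  show "64 * \<eta> * A * \<omega> / D * q = phi_HPPC D A k \<eta> \<omega> q" if "q \<in> {- (2320 * A * \<eta> / D)<..<2320 * A * \<eta> / D}" for q
    by (rule phi_HPPC_laminar[OF assms, symmetric]) (use that in auto)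
qed (use assms in auto)

text \<open>Although \<open>abs\<close> is not differentiable at \<open>0\<close>,
  \<open>phi_fs\<close> is \<open>q\<close> times a factor continuous there; by Caratheodory's
  criterion the value of that factor is the derivative.\<close>

lemma has_real_derivative_phi_fs_0:
  assumes "d \<noteq> 0"
  shows "(phi_fs \<Lambda> a b d has_real_derivative \<Lambda> * (a + b / d)) (at 0)"
proof -
  have "isCont (\<lambda>q. \<Lambda> * (\<bar>q\<bar> + a + b / (\<bar>q\<bar> + d))) 0"
    using assms by (intro continuous_intros) auto
  then show ?thesis unfolding CARAT_DERIV
    by (intro exI[of _ "\<lambda>q. \<Lambda> * (\<bar>q\<bar> + a + b / (\<bar>q\<bar> + d))"]) (simp add: phi_fs_def)
qed

text \<open>From \<open>q / (q + d) = 1 - d / (q + d)\<close>: the fraction contributes the constant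
  \<open>b\<close> and a remainder that vanishes at infinity for every \<open>d\<close>.\<close>

lemma phi_fs_eq:
  assumes "q > 0" "q + d \<noteq> 0"
  shows "phi_fs \<Lambda> a b d q = \<Lambda> * (q\<^sup>2 + a * q + b - b * d / (q + d))"
  using assms by (simp add: phi_fs_def field_simps power2_eq_square)

lemma has_real_derivative_phi_fs:
  assumes "q > \<bar>d\<bar>"
  shows "(phi_fs \<Lambda> a b d has_real_derivative \<Lambda> * (2 * q + a + b * d / (q + d)\<^sup>2)) (at q)" (is ?first)
    and "((\<lambda>q. \<Lambda> * (2 * q + a + b * d / (q + d)\<^sup>2)) has_real_derivative
           \<Lambda> * (2 - 2 * b * d / (q + d) ^ 3)) (at q)" (is ?second)
proof -
  have nz: "q + d \<noteq> 0" using assms by linarith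
  show ?first
  proof (rule has_field_derivative_transform_within_open)
    show "((\<lambda>q. \<Lambda> * (q\<^sup>2 + a * q + b - b * d / (q + d))) has_real_derivative
        \<Lambda> * (2 * q + a + b * d / (q + d)\<^sup>2)) (at q)"
      using nz by (auto intro!: derivative_eq_intros simp: power2_eq_square)
    show "\<Lambda> * (q\<^sup>2 + a * q + b - b * d / (q + d)) = phi_fs \<Lambda> a b d q" if "q \<in> {\<bar>d\<bar><..}" for q
      using that by (intro phi_fs_eq[symmetric]) auto
  qed (use assms in auto)
  show ?second
  proof -
    have "((\<lambda>q. b * d / (q + d)\<^sup>2) has_real_derivative - (b * d * (2 * (q + d))) / ((q + d)\<^sup>2)\<^sup>2) (at q)"
      using nz by (auto intro!: derivative_eq_intros simp: power2_eq_square)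
    also have "- (b * d * (2 * (q + d))) / ((q + d)\<^sup>2)\<^sup>2 = - 2 * b * d / (q + d) ^ 3"
      using nz by (simp add: divide_simps) (simp add: power4_eq_xxxx power3_eq_cube algebra_simps)
    finally have "((\<lambda>q. b * d / (q + d)\<^sup>2) has_real_derivative - 2 * b * d / (q + d) ^ 3) (at q)" .
    then have "((\<lambda>q. \<Lambda> * (2 * q + a + b * d / (q + d)\<^sup>2)) has_real_derivative
        \<Lambda> * (2 * 1 + 0 + - 2 * b * d / (q + d) ^ 3)) (at q)"
      by (intro DERIV_cmult DERIV_add DERIV_ident DERIV_const)
    then show ?thesis by simp
  qed
qed

section \<open>Comparison of the two losses at infinity and at zero\<close>

theorem theorem5p2:
  fixes D A k \<eta> \<omega> \<rho> \<alpha> t \<Lambda> a_hat b_hat e_hat a b d :: real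
  assumes "D > 0" and "A > 0" and "k > 0" and "\<eta> > 0" and "\<omega> > 0"
    and "\<rho> = k / (3.71 * D)" and "\<rho> < 1"
    and "\<alpha> = 2.51 * A * \<eta> / D"
    and "t = 2 * \<alpha> / (\<rho> * ln 10)"
    and "\<Lambda> = \<omega> * (2 * log 10 \<rho>) powi (- 2)"
    and "a_hat = 2 * t"
    and "b_hat = (ln \<rho> + 1) * t\<^sup>2 - e_hat\<^sup>2 / 2"
    and "a = a_hat"
    and "b = b_hat + e_hat\<^sup>2 / 2"
  shows
    "(\<forall>\<^sub>F q in at_infinity. twice_differentiable_at (phi_fs \<Lambda> a b d) q
                        \<and> twice_differentiable_at (phi_HPPC D A k \<eta> \<omega>) q)
     \<and> ((\<lambda>q. phi_fs \<Lambda> a b d q - phi_HPPC D A k \<eta> \<omega> q) \<longlongrightarrow> 0) at_infinity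
     \<and> ((\<lambda>q. deriv (phi_fs \<Lambda> a b d) q - deriv (phi_HPPC D A k \<eta> \<omega>) q) \<longlongrightarrow> 0) at_infinity
     \<and> ((\<lambda>q. deriv (deriv (phi_fs \<Lambda> a b d)) q
            - deriv (deriv (phi_HPPC D A k \<eta> \<omega>)) q) \<longlongrightarrow> 0) at_infinity
     \<and> (64 * \<eta> * A * \<omega> - 2 * t * D * \<Lambda> \<noteq> 0
        \<and> d = D * \<Lambda> / (64 * \<eta> * A * \<omega> - 2 * t * D * \<Lambda>) * b
        \<and> d \<noteq> 0
        \<longrightarrow> phi_fs \<Lambda> a b d differentiable at 0
          \<and> phi_HPPC D A k \<eta> \<omega> differentiable at 0
          \<and> deriv (phi_fs \<Lambda> a b d) 0 = deriv (phi_HPPC D A k \<eta> \<omega>) 0)"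
proof -
  define L where "L = - ln \<rho>"
  \<comment> \<open>Beyond \<open>M\<close> the flow is turbulent and \<open>q + d\<close> is
    positive.\<close>
  define M where "M = max (2320 * A * \<eta> / D) \<bar>d\<bar>"
  have \<rho>0: "\<rho> > 0" and t0: "t > 0" using assms(1-9) by simp_all
  have L0: "L > 0" using \<rho>0 assms(7) by (simp add: L_def)
  have "log 10 \<rho> \<noteq> 0" using L0 by (simp add: L_def log_def)
  then have \<Lambda>0: "\<Lambda> > 0" unfolding assms(10) power_int_minus using assms(5) by simp
  have M0: "M \<ge> 0" by (simp add: M_def)
  let ?v = "param_of t L"
  have a: "a = 2 * t" and b: "b = (1 - L) * t\<^sup>2" using assms(11-14) by (simp_all add: L_def)
  define f1 f2 g1 g2 where
    "f1 = (\<lambda>q. \<Lambda> * (2 * q + a + b * d / (q + d)\<^sup>2))"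
    and "f2 = (\<lambda>q. \<Lambda> * (2 - 2 * b * d / (q + d) ^ 3))"
    and "g1 = (\<lambda>q. \<Lambda> * (t * loss_deriv L (?v q)))"
    and "g2 = (\<lambda>q. \<Lambda> * loss_deriv2 L (?v q))"

  \<comment> \<open>The Colebrook solution yields some parameter for \<open>q\<close>; injectivity
    identifies it with \<open>?v q\<close>.\<close>
  have turb: "?v q \<in> flow_dom L" "flow_of t L (?v q) = q"
    "phi_HPPC D A k \<eta> \<omega> q = \<Lambda> * (t\<^sup>2 * L\<^sup>2 / (?v q)\<^sup>2)" if "q > M" for q
  proof -
    have "q > 2320 * A * \<eta> / D" using that by (simp add: M_def)
    from phi_HPPC_turbulent[OF assms(1-4,6-9) this, of \<omega>]
    obtain v where "v \<in> flow_dom L" "flow_of t L v = q"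
      "phi_HPPC D A k \<eta> \<omega> q = \<Lambda> * (t\<^sup>2 * L\<^sup>2 / v\<^sup>2)"
      unfolding L_def assms(10) by blast
    with param_of_flow_of[OF t0] show "?v q \<in> flow_dom L" "flow_of t L (?v q) = q"
      "phi_HPPC D A k \<eta> \<omega> q = \<Lambda> * (t\<^sup>2 * L\<^sup>2 / (?v q)\<^sup>2)" by auto
  qed
  have v_lim: "filterlim ?v (at_right 0) at_top"
    using turb(1,2) by (intro filterlim_param_of[OF t0, of M]) (metis image_eqI)
  have ev: "\<forall>\<^sub>F q in at_top. q > M" by (rule eventually_gt_at_top)

  have f1: "(phi_fs \<Lambda> a b d has_real_derivative f1 q) (at q)"
    and f2: "(f1 has_real_derivative f2 q) (at q)" if "q > M" for q
    using has_real_derivative_phi_fs[of d q] that unfolding f1_def f2_def M_def by auto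
  have g1: "(phi_HPPC D A k \<eta> \<omega> has_real_derivative g1 q) (at q)" if "q > M" for q
  proof (rule has_field_derivative_transform_within_open[where S = "{M<..}"])
    show "((\<lambda>q. \<Lambda> * (t\<^sup>2 * L\<^sup>2 / (?v q)\<^sup>2)) has_real_derivative g1 q) (at q)"
      using DERIV_cmult[OF has_real_derivative_loss(1)[OF t0 turb(1)[OF that]], of \<Lambda>]
      unfolding g1_def turb(2)[OF that] .
  qed (use that turb(3) in auto)
  have g2: "(g1 has_real_derivative g2 q) (at q)" if "q > M" for q
    using DERIV_cmult[OF has_real_derivative_loss(2)[OF t0 turb(1)[OF that]], of \<Lambda>]
    unfolding g1_def g2_def turb(2)[OF that] .
  note fs = phi_fs_minus f1 f2 and hppc = phi_HPPC_minus g1 g2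

  have lim0: "((\<lambda>q. phi_fs \<Lambda> a b d q - phi_HPPC D A k \<eta> \<omega> q) \<longlongrightarrow> 0) at_top"
  proof (rule Lim_transform_eventually)
    show "((\<lambda>q. \<Lambda> * (((flow_of t L (?v q))\<^sup>2 + 2 * t * flow_of t L (?v q) - t\<^sup>2 * L\<^sup>2 / (?v q)\<^sup>2)
        + b - b * d / (q + d))) \<longlongrightarrow> 0) at_top"
    proof (rule tendsto_eq_rhs)
      \<comment> \<open>The limit \<open>(L - 1) * t\<^sup>2\<close> of the first group is cancelled
        by \<open>b\<close>.\<close>
      have "((\<lambda>q. b * d / (q + d)) \<longlongrightarrow> 0) at_top" by real_asymp
      then show "((\<lambda>q. \<Lambda> * (((flow_of t L (?v q))\<^sup>2 + 2 * t * flow_of t L (?v q) - t\<^sup>2 * L\<^sup>2 / (?v q)\<^sup>2)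
        + b - b * d / (q + d))) \<longlongrightarrow> \<Lambda> * ((L - 1) * t\<^sup>2 + b - 0)) at_top"
        by (intro tendsto_mult_left tendsto_diff tendsto_add tendsto_const
            filterlim_compose[OF flow_of_asymptotics(1)[OF L0] v_lim])
    qed (simp add: b algebra_simps)
    show "\<forall>\<^sub>F q in at_top. \<Lambda> * (((flow_of t L (?v q))\<^sup>2 + 2 * t * flow_of t L (?v q) - t\<^sup>2 * L\<^sup>2 / (?v q)\<^sup>2)
        + b - b * d / (q + d)) = phi_fs \<Lambda> a b d q - phi_HPPC D A k \<eta> \<omega> q"
      using ev
    proof eventually_elim
      case (elim q)
      then have "q > 0" "q + d \<noteq> 0" using M0 by (auto simp: M_def)
      then have "phi_fs \<Lambda> a b d q = \<Lambda> * (q\<^sup>2 + a * q + b - b * d / (q + d))" by (rule phi_fs_eq)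
      then show ?case by (simp add: turb(2,3)[OF elim] a right_diff_distrib distrib_left)
    qed
  qed
  have lim1: "((\<lambda>q. f1 q - g1 q) \<longlongrightarrow> 0) at_top"
  proof (rule Lim_transform_eventually)
    have "((\<lambda>q. b * d / (q + d)\<^sup>2) \<longlongrightarrow> 0) at_top" by real_asymp
    then have "((\<lambda>q. \<Lambda> * ((2 * flow_of t L (?v q) + 2 * t - t * loss_deriv L (?v q)) + b * d / (q + d)\<^sup>2))
        \<longlongrightarrow> \<Lambda> * (0 + 0)) at_top"
      by (intro tendsto_mult_left tendsto_add filterlim_compose[OF flow_of_asymptotics(2)[OF L0] v_lim])
    then show "((\<lambda>q. \<Lambda> * ((2 * flow_of t L (?v q) + 2 * t - t * loss_deriv L (?v q)) + b * d / (q + d)\<^sup>2))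
        \<longlongrightarrow> 0) at_top" by simp
    show "\<forall>\<^sub>F q in at_top. \<Lambda> * ((2 * flow_of t L (?v q) + 2 * t - t * loss_deriv L (?v q))
        + b * d / (q + d)\<^sup>2) = f1 q - g1 q"
      using ev by eventually_elim (simp add: turb(2) f1_def g1_def a right_diff_distrib distrib_left)
  qed
  have lim2: "((\<lambda>q. f2 q - g2 q) \<longlongrightarrow> 0) at_top"
  proof (rule tendsto_eq_rhs)
    have "((\<lambda>q. 2 * b * d / (q + d) ^ 3) \<longlongrightarrow> 0) at_top" by real_asymp
    then show "((\<lambda>q. f2 q - g2 q) \<longlongrightarrow> \<Lambda> * (2 - 0) - \<Lambda> * 2) at_top"
      unfolding f2_def g2_def
      by (intro tendsto_mult_left tendsto_diff tendsto_const
          filterlim_compose[OF flow_of_asymptotics(3)[OF L0] v_lim])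
  qed simp

  note abs_lim = filterlim_abs_at_infinity
  have ev_inf: "\<forall>\<^sub>F q in at_infinity. \<bar>q\<bar> > M"
    using eventually_compose_filterlim[OF ev abs_lim] .

  have "\<forall>\<^sub>F q in at_infinity. twice_differentiable_at (phi_fs \<Lambda> a b d) q
      \<and> twice_differentiable_at (phi_HPPC D A k \<eta> \<omega>) q"
    using ev_inf by eventually_elim
      (use twice_differentiable_at_odd[OF M0 fs] twice_differentiable_at_odd[OF M0 hppc] in blast)
  moreover have "((\<lambda>q. phi_fs \<Lambda> a b d q - phi_HPPC D A k \<eta> \<omega> q) \<longlongrightarrow> 0) at_infinity"
  proof -
    \<comment> \<open>This includes \<open>q = 0\<close>, where both functions vanish.\<close>
    have "sgn q * (phi_fs \<Lambda> a b d \<bar>q\<bar> - phi_HPPC D A k \<eta> \<omega> \<bar>q\<bar>)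
        = phi_fs \<Lambda> a b d q - phi_HPPC D A k \<eta> \<omega> q" for q
      by (auto simp: sgn_real_def abs_real_def phi_fs_minus phi_HPPC_minus)
        (simp_all add: phi_fs_def phi_HPPC_def)
    with tendsto_sgn_mult_abs_at_infinity[OF lim0] show ?thesis by simp
  qed
  moreover have "((\<lambda>q. deriv (phi_fs \<Lambda> a b d) q - deriv (phi_HPPC D A k \<eta> \<omega>) q) \<longlongrightarrow> 0) at_infinity"
  proof (rule Lim_transform_eventually[OF filterlim_compose[OF lim1 abs_lim]])
    show "\<forall>\<^sub>F q in at_infinity. f1 \<bar>q\<bar> - g1 \<bar>q\<bar>
        = deriv (phi_fs \<Lambda> a b d) q - deriv (phi_HPPC D A k \<eta> \<omega>) q"
      using ev_inf by eventually_elim (simp add: deriv_odd_abs[OF M0 fs] deriv_odd_abs[OF M0 hppc])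
  qed
  moreover have "((\<lambda>q. deriv (deriv (phi_fs \<Lambda> a b d)) q
      - deriv (deriv (phi_HPPC D A k \<eta> \<omega>)) q) \<longlongrightarrow> 0) at_infinity"
  proof (rule Lim_transform_eventually[OF tendsto_sgn_mult_abs_at_infinity[OF lim2]])
    show "\<forall>\<^sub>F q in at_infinity. sgn q * (f2 \<bar>q\<bar> - g2 \<bar>q\<bar>)
        = deriv (deriv (phi_fs \<Lambda> a b d)) q - deriv (deriv (phi_HPPC D A k \<eta> \<omega>)) q"
      using ev_inf by eventually_elim
        (simp add: deriv_deriv_odd_abs[OF M0 fs] deriv_deriv_odd_abs[OF M0 hppc] right_diff_distrib)
  qed
  moreover have "phi_fs \<Lambda> a b d differentiable at 0 \<and> phi_HPPC D A k \<eta> \<omega> differentiable at 0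
      \<and> deriv (phi_fs \<Lambda> a b d) 0 = deriv (phi_HPPC D A k \<eta> \<omega>) 0"
    if nz: "64 * \<eta> * A * \<omega> - 2 * t * D * \<Lambda> \<noteq> 0"
      and d: "d = D * \<Lambda> / (64 * \<eta> * A * \<omega> - 2 * t * D * \<Lambda>) * b" and d0: "d \<noteq> 0"
  proof -
    \<comment> \<open>The prescribed \<open>d\<close> solves
      \<open>\<Lambda> * (2 * t + b / d) = 64 * \<eta> * A * \<omega> / D\<close>, which equates the
      slope of \<open>phi_fs\<close> at \<open>0\<close> with the laminar one. That \<open>b\<close>
      is nonzero allows the formula for \<open>d\<close> to be inverted.\<close>
    have "b \<noteq> 0" using d d0 by auto
    then have "b / d = (64 * \<eta> * A * \<omega> - 2 * t * D * \<Lambda>) / (D * \<Lambda>)"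
      using d nz \<Lambda>0 assms(1) by simp
    then have "\<Lambda> * (a + b / d) = 64 * \<eta> * A * \<omega> / D"
      using \<Lambda>0 assms(1) by (simp add: a field_simps)
    with has_real_derivative_phi_fs_0[OF d0, of \<Lambda> a b]
    have "(phi_fs \<Lambda> a b d has_real_derivative 64 * \<eta> * A * \<omega> / D) (at 0)" by simp
    with has_real_derivative_phi_HPPC_0[OF assms(1,2,4), of k \<omega>] show ?thesis
      using DERIV_imp_deriv real_differentiable_def by metis
  qed
  ultimately show ?thesis by blast
qed

end
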